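(* For $x>0$ the following sign identities hold: (i) if $c_1>a>0$ and $c_2>a>0$, then $$\operatorname{sgn}\, D_a\!\left(\frac{M(a,c_1,x)}{M(a,c_2,x)}\right)=\operatorname{sgn}(c_2-c_1);$$ (ii) if $c>a_1>0$ and $c>a_2>0$, then $$\operatorname{sgn}\, D_c\!\left(\frac{M(a_1,c,x)}{M(a_2,c,x)}\right)=\operatorname{sgn}(a_2-a_1).$$
   Context: All parameters are real. Kummer's function is $M(a,c,x)=\sum_{j\ge 0}\frac{(a)_j}{(c)_j}\frac{x^j}{j!}$, where $(a)_j=a(a+1)\cdots(a+j-1)$ and $(a)_0=1$. $D_a$ and $D_c$ denote partial derivatives with respect to the parameters $a$ and $c$ (the other quantities held fixed), and $\operatorname{sgn}$ takes values in $\{-1,0,1\}$. *)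

theory Defs
  imports "HOL-Analysis.Analysis"
begin

text \<open>The series converges whenever \<open>c\<close> is not a non-positive integer.\<close>

definition kummer_M :: "real \<Rightarrow> real \<Rightarrow> real \<Rightarrow> real" where
  "kummer_M a c x = (\<Sum>j. pochhammer a j / pochhammer c j * (x ^ j / fact j))"

end

theory Submission
  imports Defs "HOL-Real_Asymp.Real_Asymp"
begin

text \<open>
  Logarithmic differentiation of the series multiplies its \<open>j\<close>-th term by the partial harmonic sum
  \<open>\<Sum>i<j. 1 / (a + i)\<close> (for \<open>a\<close>) or \<open>- (\<Sum>i<j. 1 / (c + i))\<close> (for \<open>c\<close>). Hence
  \<open>D\<^sub>a log M\<close> and \<open>- D\<^sub>c log M\<close> are means of a strictly increasing sequence with respect to the
  weights \<open>(a)\<^sub>j / (c)\<^sub>j x\<^sup>j / j!\<close>, and the quotient of two such families of weights, with different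
  \<open>c\<close> or different \<open>a\<close>, is strictly monotone in \<open>j\<close>. A mean of an increasing sequence grows under
  such a change of weights (Chebyshev's sum inequality).
\<close>

section \<open>Chebyshev's sum inequality for series, and the sign of the derivative of a
  quotient\<close>

text \<open>With \<mu> the \<open>q\<close>-mean of \<open>h\<close>, the claim amounts to
  positivity of the sum of \<open>p j * (h j - \<mu>)\<close>. The deviations weighted by
  \<open>q\<close> sum to 0, so any constant may be subtracted from \<open>p j / q j\<close>; a
  suitable one makes every summand nonnegative.\<close>

lemma Chebyshev_suminf_strict:
  fixes p q h :: "nat \<Rightarrow> real"
  assumes q: "\<And>j. q j > 0"
    and pq: "strict_mono (\<lambda>j. p j / q j)" and h: "strict_mono h"
    and sums: "summable p" "summable q" "summable (\<lambda>j. p j * h j)" "summable (\<lambda>j. q j * h j)"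
  shows "(\<Sum>j. p j) * (\<Sum>j. q j * h j) < (\<Sum>j. p j * h j) * (\<Sum>j. q j)"
proof -
  define \<mu> where "\<mu> = (\<Sum>j. q j * h j) / (\<Sum>j. q j)"
  have Q: "(\<Sum>j. q j) > 0"
    using q sums(2) by (intro suminf_pos) auto
  have dev: "(\<lambda>j. w j * (h j - \<mu>)) sums ((\<Sum>j. w j * h j) - (\<Sum>j. w j) * \<mu>)"
    if "summable w" "summable (\<lambda>j. w j * h j)" for w :: "nat \<Rightarrow> real"
    using sums_diff[OF summable_sums[OF that(2)] sums_mult2[OF summable_sums[OF that(1)], of \<mu>]]
    by (simp add: algebra_simps)
  have q0: "(\<lambda>j. q j * (h j - \<mu>)) sums 0"
    using dev[OF sums(2,4)] Q by (simp add: \<mu>_def)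
  have below: "h 0 < \<mu>"
  proof (rule ccontr)
    assume "\<not> h 0 < \<mu>"
    then have ge: "h j - \<mu> \<ge> 0" for j
      using strict_mono_less_eq[OF h, of 0 j] by simp
    \<comment> \<open>Index 1 supplies the strictly positive term, since \<open>h 0 = \<mu>\<close>
      is not excluded here.\<close>
    have "h 1 - \<mu> > 0"
      using ge[of 0] strict_monoD[OF h, of 0 1] by simp
    then have "0 < (\<Sum>j. q j * (h j - \<mu>))"
      using q ge q0 by (intro suminf_pos2[where i = 1]) (auto simp: sums_iff less_imp_le)
    then show False
      using q0 by (simp add: sums_iff)
  qed
  have "\<exists>j. h j > \<mu>"
  proof (rule ccontr)
    assume "\<nexists>j. h j > \<mu>"
    then have "0 < (\<Sum>j. q j * (\<mu> - h j))"
      using q below sums_minus[OF q0]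
      by (intro suminf_pos2[where i = 0]) (auto simp: sums_iff less_imp_le not_less algebra_simps)
    then show False
      using sums_minus[OF q0] by (simp add: sums_iff algebra_simps)
  qed
  define N where "N = (LEAST j. h j > \<mu>)"
  have N: "h N > \<mu>"
    unfolding N_def by (rule LeastI_ex) fact
  have N_least: "h j \<le> \<mu>" if "j < N" for j
    using not_less_Least[OF that[unfolded N_def]] by simp
  have "N > 0"
    using N below by (cases N) auto
  \<comment> \<open>Both factors change sign at the crossing index \<open>N\<close>: they are at
    most 0 before it and at least 0 from it on.\<close>
  let ?d = "\<lambda>j. (p j / q j - p N / q N) * (q j * (h j - \<mu>))"
  have "?d = (\<lambda>j. p j * (h j - \<mu>) - p N / q N * (q j * (h j - \<mu>)))"
    using less_imp_neq[OF q, symmetric] by (simp add: fun_eq_iff right_diff_distrib left_diff_distrib)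
  then have d: "?d sums ((\<Sum>j. p j * h j) - (\<Sum>j. p j) * \<mu>)"
    using sums_diff[OF dev[OF sums(1,3)] sums_mult[OF q0, of "p N / q N"]] by simp
  have d_nonneg: "?d j \<ge> 0" for j
  proof (cases "j < N")
    case True
    then show ?thesis
      using N_least[OF True] strict_monoD[OF pq True] q[of j]
      by (intro mult_nonpos_nonpos mult_nonneg_nonpos) auto
  next
    case False
    then have "p N / q N \<le> p j / q j" "h N \<le> h j"
      using strict_mono_less_eq[OF pq, of N j] strict_mono_less_eq[OF h, of N j] by auto
    then show ?thesis
      using N q[of j] by (intro mult_nonneg_nonneg) auto
  qed
  \<comment> \<open>Strictness comes from index 0, where both factors are negative because
    \<open>N > 0\<close>.\<close>
  have "?d 0 > 0"
    using strict_monoD[OF pq \<open>N > 0\<close>] below q[of 0] by (intro mult_neg_neg mult_pos_neg) auto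
  then have "0 < (\<Sum>j. ?d j)"
    using d d_nonneg by (intro suminf_pos2[where i = 0]) (auto simp: sums_iff)
  then have "0 < (\<Sum>j. p j * h j) - (\<Sum>j. p j) * \<mu>"
    using d by (simp add: sums_iff)
  then show ?thesis
    using Q by (simp add: \<mu>_def field_simps)
qed

text \<open>The denominator in the quotient rule is a positive square, so the numerator decides the
  sign. Differentiability is stated too, because a value of \<open>deriv\<close> alone does not
  assert that a derivative exists.\<close>

lemma sgn_deriv_quotient:
  fixes F G :: "real \<Rightarrow> real"
  assumes "(F has_field_derivative F') (at t)" "(G has_field_derivative G') (at t)" "G t > 0"
  shows "(\<lambda>t. F t / G t) field_differentiable (at t) \<and>
    sgn (deriv (\<lambda>t. F t / G t) t) = sgn (F' * G t - F t * G')"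
proof -
  have D: "((\<lambda>t. F t / G t) has_field_derivative (F' * G t - F t * G') / (G t * G t)) (at t)"
    using DERIV_divide[OF assms(1,2)] assms(3) by simp
  moreover have "sgn ((F' * G t - F t * G') / (G t * G t)) = sgn (F' * G t - F t * G')"
    using assms(3) by (simp add: sgn_divide sgn_mult)
  ultimately show ?thesis
    using D DERIV_imp_deriv[OF D] by (auto simp: field_differentiable_def)
qed

section \<open>Terms of the Kummer series: positivity, bounds and summability\<close>

definition kummer_term :: "real \<Rightarrow> real \<Rightarrow> real \<Rightarrow> nat \<Rightarrow> real" where
  "kummer_term a c x j = pochhammer a j / pochhammer c j * (x ^ j / fact j)"

text \<open>For \<open>a > 0\<close> this is the logarithmic derivative of
  \<open>pochhammer a j\<close> in \<open>a\<close>, a difference of digamma values at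
  \<open>a + j\<close> and \<open>a\<close>.\<close>

definition shifted_harm :: "real \<Rightarrow> nat \<Rightarrow> real" where
  "shifted_harm a j = (\<Sum>i<j. 1 / (a + real i))"

lemma kummer_M_eq_suminf: "kummer_M a c x = (\<Sum>j. kummer_term a c x j)"
  by (simp add: kummer_M_def kummer_term_def)

lemma kummer_term_pos: "a > 0 \<Longrightarrow> c > 0 \<Longrightarrow> x > 0 \<Longrightarrow> kummer_term a c x j > 0"
  by (simp add: kummer_term_def pochhammer_pos)

lemma kummer_term_Suc:
  "kummer_term a c x (Suc j) = kummer_term a c x j * ((a + j) / (c + j) * (x / Suc j))"
  by (simp add: kummer_term_def pochhammer_Suc field_simps)

lemma strict_mono_shifted_harm: "a > 0 \<Longrightarrow> strict_mono (shifted_harm a)"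
  by (auto simp: strict_mono_Suc_iff shifted_harm_def intro!: divide_pos_pos add_pos_nonneg)

lemma shifted_harm_nonneg: "a > 0 \<Longrightarrow> shifted_harm a j \<ge> 0"
  by (auto simp: shifted_harm_def intro!: sum_nonneg divide_nonneg_pos add_pos_nonneg)

lemma shifted_harm_le:
  assumes "0 < l" "l \<le> a"
  shows "shifted_harm a j \<le> real j / l"
proof -
  have "shifted_harm a j \<le> (\<Sum>i<j. 1 / l)"
    unfolding shifted_harm_def using assms by (intro sum_mono divide_left_mono) auto
  then show ?thesis by simp
qed

lemma pochhammer_mono:
  fixes a b :: real
  assumes "0 < a" "a \<le> b"
  shows "pochhammer a j \<le> pochhammer b j"
  using assms by (auto simp: pochhammer_prod intro!: prod_mono)

lemma kummer_term_mono:
  assumes "0 < a" "a \<le> a'" "0 < c'" "c' \<le> c" "x > 0"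
  shows "kummer_term a c x j \<le> kummer_term a' c' x j"
  unfolding kummer_term_def using assms
  by (intro mult_right_mono frac_le pochhammer_mono) (auto simp: pochhammer_pos less_imp_le)

text \<open>The extra factor \<open>j\<close> absorbs the linear bound on
  \<open>shifted_harm\<close>; the ratio of consecutive terms still tends to 0.\<close>

lemma summable_kummer_term_times_index:
  assumes "a > 0" "c > 0" "x > 0"
  shows "summable (\<lambda>j. real j * kummer_term a c x j)"
proof -
  have "(\<lambda>j. (a + real j) / (c + real j) * (x / real j)) \<longlonglongrightarrow> 0"
    by real_asymp
  then have "\<forall>\<^sub>F j in sequentially. (a + real j) / (c + real j) * (x / real j) < 1/2"
    by (rule order_tendstoD) simp
  then obtain N where N: "\<And>j. j \<ge> N \<Longrightarrow> (a + real j) / (c + real j) * (x / real j) < 1/2"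
    by (auto simp: eventually_sequentially)
  show ?thesis
  \<comment> \<open>Starting at \<open>Suc N\<close> keeps \<open>j\<close> nonzero; at
    \<open>j = 0\<close> the ratio formula fails, as \<open>x / 0 = 0\<close>.\<close>
  proof (rule summable_ratio_test[where c = "1/2" and N = "Suc N"])
    fix j assume j: "j \<ge> Suc N"
    have t: "kummer_term a c x j > 0" "kummer_term a c x (Suc j) > 0"
      using assms by (auto simp: kummer_term_pos)
    have "real (Suc j) * kummer_term a c x (Suc j)
        = real j * kummer_term a c x j * ((a + real j) / (c + real j) * (x / real j))"
    proof -
      have "real (Suc j) * (x / real (Suc j)) = real j * (x / real j)"
        using j by simp
      then show ?thesis
        unfolding kummer_term_Suc by (metis mult.assoc mult.left_commute)
    qed
    also have "\<dots> \<le> real j * kummer_term a c x j * (1/2)"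
      using N[of j] j t by (intro mult_left_mono) auto
    finally show "norm (real (Suc j) * kummer_term a c x (Suc j))
        \<le> 1/2 * norm (real j * kummer_term a c x j)"
      using t by (simp add: abs_mult)
  qed simp
qed

lemma summable_kummer_term:
  assumes "a > 0" "c > 0" "x > 0"
  shows "summable (kummer_term a c x)"
proof (rule summable_comparison_test'[where N = 1])
  show "summable (\<lambda>j. real j * kummer_term a c x j)"
    using assms by (rule summable_kummer_term_times_index)
  show "norm (kummer_term a c x j) \<le> real j * kummer_term a c x j" if "j \<ge> 1" for j
    using that kummer_term_pos[OF assms, of j] by (simp add: mult_le_cancel_right1)
qed

lemma summable_kummer_term_shifted_harm:
  assumes "a > 0" "c > 0" "x > 0" "b > 0"
  shows "summable (\<lambda>j. kummer_term a c x j * shifted_harm b j)"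
proof (rule summable_comparison_test'[where N = 0])
  show "summable (\<lambda>j. (real j * kummer_term a c x j) * (1 / b))"
    using assms by (intro summable_mult2 summable_kummer_term_times_index)
  show "norm (kummer_term a c x j * shifted_harm b j) \<le> (real j * kummer_term a c x j) * (1 / b)" for j
    using mult_left_mono[OF shifted_harm_le[of b b j], of "kummer_term a c x j"]
      kummer_term_pos[OF assms(1-3), of j] shifted_harm_nonneg[OF assms(4), of j] assms
    by (simp add: abs_mult field_simps)
qed

lemma kummer_M_pos: "a > 0 \<Longrightarrow> c > 0 \<Longrightarrow> x > 0 \<Longrightarrow> kummer_M a c x > 0"
  unfolding kummer_M_eq_suminf
  by (intro suminf_pos summable_kummer_term kummer_term_pos)

section \<open>Termwise differentiation in the parameters\<close>

lemma has_field_derivative_pochhammer: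
  assumes "t > 0"
  shows "((\<lambda>t. pochhammer t j) has_field_derivative pochhammer t j * shifted_harm t j) (at t)"
proof (induction j)
  case (Suc j)
  have "t + real j \<noteq> 0" using assms by simp
  then show ?case
    unfolding pochhammer_Suc
    by (auto intro!: derivative_eq_intros Suc simp: shifted_harm_def field_simps)
qed (simp add: shifted_harm_def)

lemma has_field_derivative_kummer_term_fst:
  assumes "t > 0"
  shows "((\<lambda>t. kummer_term t c x j) has_field_derivative kummer_term t c x j * shifted_harm t j) (at t)"
  unfolding kummer_term_def
  by (auto intro!: derivative_eq_intros has_field_derivative_pochhammer assms simp: divide_inverse)

lemma has_field_derivative_kummer_term_snd:
  assumes "t > 0"
  shows "((\<lambda>t. kummer_term a t x j) has_field_derivative - (kummer_term a t x j * shifted_harm t j)) (at t)"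
  unfolding kummer_term_def using pochhammer_pos[OF assms, of j]
  by (auto intro!: derivative_eq_intros has_field_derivative_pochhammer assms simp: field_simps)

text \<open>The Weierstrass M-test makes the series of derivatives converge uniformly on the
  interval; convergence of the original series at \<open>t\<close> anchors it.\<close>

lemma has_field_derivative_suminf_dominated:
  fixes f f' :: "nat \<Rightarrow> real \<Rightarrow> real"
  assumes "l < t" "t < u"
    and deriv: "\<And>j s. l < s \<Longrightarrow> s < u \<Longrightarrow> (f j has_field_derivative f' j s) (at s)"
    and bound: "\<And>j s. l < s \<Longrightarrow> s < u \<Longrightarrow> norm (f' j s) \<le> B j"
    and "summable B" "summable (\<lambda>j. f j t)"
  shows "((\<lambda>t. \<Sum>j. f j t) has_field_derivative (\<Sum>j. f' j t)) (at t)"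
proof (rule has_field_derivative_series'(2)[where S = "{l<..<u}" and f' = f' and ?x0.0 = t])
  show "uniformly_convergent_on {l<..<u} (\<lambda>n s. \<Sum>j<n. f' j s)"
    using bound \<open>summable B\<close> by (intro Weierstrass_m_test'[where M = B]) auto
qed (use assms in \<open>auto intro: has_field_derivative_at_within\<close>)

lemma has_field_derivative_kummer_M_fst:
  assumes "a > 0" "c > 0" "x > 0"
  shows "((\<lambda>t. kummer_M t c x) has_field_derivative
    (\<Sum>j. kummer_term a c x j * shifted_harm a j)) (at a)"
  unfolding kummer_M_eq_suminf
\<comment> \<open>Terms grow with the first parameter, so the right end \<open>2*a\<close> bounds
  them, while the left end bounds the harmonic factor by \<open>j / (a/2)\<close>.\<close>
proof (rule has_field_derivative_suminf_dominated[where l = "a/2" and u = "2*a" and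
      B = "\<lambda>j. (real j * kummer_term (2*a) c x j) * (2/a)"])
  fix j s assume s: "a/2 < s" "s < 2*a"
  then have "s > 0" using assms by linarith
  then show "((\<lambda>t. kummer_term t c x j) has_field_derivative
      kummer_term s c x j * shifted_harm s j) (at s)"
    by (rule has_field_derivative_kummer_term_fst)
  have "kummer_term s c x j * shifted_harm s j \<le> kummer_term (2*a) c x j * (real j / (a/2))"
    using s \<open>s > 0\<close> assms kummer_term_pos[of "2*a" c x j]
    by (intro mult_mono kummer_term_mono shifted_harm_le shifted_harm_nonneg) auto
  then show "norm (kummer_term s c x j * shifted_harm s j)
      \<le> (real j * kummer_term (2*a) c x j) * (2/a)"
    using kummer_term_pos[OF \<open>s > 0\<close> assms(2,3), of j] shifted_harm_nonneg[OF \<open>s > 0\<close>, of j]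
    by (simp add: abs_mult mult_ac)
qed (use assms in \<open>auto intro!: summable_mult2 summable_kummer_term_times_index summable_kummer_term\<close>)

lemma has_field_derivative_kummer_M_snd:
  assumes "a > 0" "c > 0" "x > 0"
  shows "((\<lambda>t. kummer_M a t x) has_field_derivative
    - (\<Sum>j. kummer_term a c x j * shifted_harm c j)) (at c)"
  unfolding kummer_M_eq_suminf suminf_minus[OF summable_kummer_term_shifted_harm[OF assms assms(2)], symmetric]
\<comment> \<open>Terms decrease in the second parameter, so the left end \<open>c/2\<close> bounds
  both factors.\<close>
proof (rule has_field_derivative_suminf_dominated[where l = "c/2" and u = "2*c" and
      B = "\<lambda>j. (real j * kummer_term a (c/2) x j) * (2/c)"])
  fix j s assume s: "c/2 < s" "s < 2*c"
  then have "s > 0" using assms by linarith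
  then show "((\<lambda>t. kummer_term a t x j) has_field_derivative
      - (kummer_term a s x j * shifted_harm s j)) (at s)"
    by (rule has_field_derivative_kummer_term_snd)
  have "kummer_term a s x j * shifted_harm s j \<le> kummer_term a (c/2) x j * (real j / (c/2))"
    using s \<open>s > 0\<close> assms kummer_term_pos[of a "c/2" x j]
    by (intro mult_mono kummer_term_mono shifted_harm_le shifted_harm_nonneg) auto
  then show "norm (- (kummer_term a s x j * shifted_harm s j))
      \<le> (real j * kummer_term a (c/2) x j) * (2/c)"
    using kummer_term_pos[OF assms(1) \<open>s > 0\<close> assms(3), of j] shifted_harm_nonneg[OF \<open>s > 0\<close>, of j]
    by (simp add: abs_mult mult_ac)
qed (use assms in \<open>auto intro!: summable_mult2 summable_kummer_term_times_index summable_kummer_term\<close>)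

section \<open>Monotone quotients of weights and comparison of logarithmic derivatives\<close>

lemma strict_mono_pochhammer_quotient:
  fixes a b :: real
  assumes "0 < a" "a < b"
  shows "strict_mono (\<lambda>j. pochhammer b j / pochhammer a j)"
  unfolding strict_mono_Suc_iff
proof
  fix j
  have "pochhammer b j / pochhammer a j > 0"
    using assms by (simp add: pochhammer_pos)
  moreover have "(b + real j) / (a + real j) > 1"
    using assms by simp
  ultimately have "pochhammer b j / pochhammer a j
      < pochhammer b j / pochhammer a j * ((b + real j) / (a + real j))"
    by (simp only: mult_less_cancel_left1) simp
  then show "pochhammer b j / pochhammer a j < pochhammer b (Suc j) / pochhammer a (Suc j)"
    by (simp add: pochhammer_Suc)
qed

lemma strict_mono_kummer_term_quotient_fst:
  assumes "0 < a" "a < b" "c > 0" "x > 0"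
  shows "strict_mono (\<lambda>j. kummer_term b c x j / kummer_term a c x j)"
proof -
  have "(\<lambda>j. kummer_term b c x j / kummer_term a c x j) = (\<lambda>j. pochhammer b j / pochhammer a j)"
    using less_imp_neq[OF pochhammer_pos[OF assms(3)], symmetric] assms(4)
    by (simp add: kummer_term_def fun_eq_iff)
  then show ?thesis
    using strict_mono_pochhammer_quotient[OF assms(1,2)] by simp
qed

text \<open>The second parameter sits in the denominators, so cancelling the common factors inverts
  the Pochhammer quotient; hence the smaller parameter stands on top.\<close>

lemma strict_mono_kummer_term_quotient_snd:
  assumes "a > 0" "0 < c" "c < d" "x > 0"
  shows "strict_mono (\<lambda>j. kummer_term a c x j / kummer_term a d x j)"
proof -
  have "(\<lambda>j. kummer_term a c x j / kummer_term a d x j) = (\<lambda>j. pochhammer d j / pochhammer c j)"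
    using less_imp_neq[OF pochhammer_pos[OF assms(1)], symmetric] assms(4)
    by (simp add: kummer_term_def fun_eq_iff)
  then show ?thesis
    using strict_mono_pochhammer_quotient[OF assms(2,3)] by simp
qed

text \<open>Divided by both values of \<open>kummer_M\<close>, this says that the logarithmic
  derivative in the first parameter strictly decreases in the second.\<close>

lemma kummer_harm_mean_less_snd:
  assumes "a > 0" "0 < c" "c < d" "x > 0"
  shows "kummer_M a c x * (\<Sum>j. kummer_term a d x j * shifted_harm a j)
    < (\<Sum>j. kummer_term a c x j * shifted_harm a j) * kummer_M a d x"
  unfolding kummer_M_eq_suminf using assms
  by (intro Chebyshev_suminf_strict strict_mono_kummer_term_quotient_snd strict_mono_shifted_harm
      kummer_term_pos summable_kummer_term summable_kummer_term_shifted_harm) auto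

text \<open>Here the means are the negated logarithmic derivatives in \<open>c\<close>; they
  strictly increase with the first parameter.\<close>

lemma kummer_harm_mean_less_fst:
  assumes "0 < a" "a < b" "c > 0" "x > 0"
  shows "kummer_M b c x * (\<Sum>j. kummer_term a c x j * shifted_harm c j)
    < (\<Sum>j. kummer_term b c x j * shifted_harm c j) * kummer_M a c x"
  unfolding kummer_M_eq_suminf using assms
  by (intro Chebyshev_suminf_strict strict_mono_kummer_term_quotient_fst strict_mono_shifted_harm
      kummer_term_pos summable_kummer_term summable_kummer_term_shifted_harm) auto

theorem theorem1:
  fixes x :: real
  assumes "x > 0"
  shows
    "(\<forall>a c\<^sub>1 c\<^sub>2 :: real. c\<^sub>1 > a \<and> c\<^sub>2 > a \<and> a > 0 \<longrightarrow>
        (\<lambda>t. kummer_M t c\<^sub>1 x / kummer_M t c\<^sub>2 x) field_differentiable (at a) \<and>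
        sgn (deriv (\<lambda>t. kummer_M t c\<^sub>1 x / kummer_M t c\<^sub>2 x) a) = sgn (c\<^sub>2 - c\<^sub>1)) \<and>
     (\<forall>a\<^sub>1 a\<^sub>2 c :: real. c > a\<^sub>1 \<and> c > a\<^sub>2 \<and> a\<^sub>1 > 0 \<and> a\<^sub>2 > 0 \<longrightarrow>
        (\<lambda>t. kummer_M a\<^sub>1 t x / kummer_M a\<^sub>2 t x) field_differentiable (at c) \<and>
        sgn (deriv (\<lambda>t. kummer_M a\<^sub>1 t x / kummer_M a\<^sub>2 t x) c) = sgn (a\<^sub>2 - a\<^sub>1))"
\<comment> \<open>Instantiating \<open>conjI\<close> splits only the outer conjunction; the inner
  ones match \<open>sgn_deriv_quotient\<close>.\<close>
proof (intro conjI[of "All _"] allI impI)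
  fix a c\<^sub>1 c\<^sub>2 :: real
  assume "c\<^sub>1 > a \<and> c\<^sub>2 > a \<and> a > 0"
  then have pos: "a > 0" "c\<^sub>1 > 0" "c\<^sub>2 > 0" by auto
  let ?S = "\<lambda>c. \<Sum>j. kummer_term a c x j * shifted_harm a j"
  \<comment> \<open>This is the quotient-rule numerator. The comparison of means settles either
    strict order; for equal parameters the two products cancel.\<close>
  have "sgn (?S c\<^sub>1 * kummer_M a c\<^sub>2 x - kummer_M a c\<^sub>1 x * ?S c\<^sub>2) = sgn (c\<^sub>2 - c\<^sub>1)"
    using kummer_harm_mean_less_snd[of a c\<^sub>1 c\<^sub>2 x] kummer_harm_mean_less_snd[of a c\<^sub>2 c\<^sub>1 x] pos assms
    by (cases c\<^sub>1 c\<^sub>2 rule: linorder_cases) (auto simp: mult.commute)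
  then show "(\<lambda>t. kummer_M t c\<^sub>1 x / kummer_M t c\<^sub>2 x) field_differentiable (at a) \<and>
      sgn (deriv (\<lambda>t. kummer_M t c\<^sub>1 x / kummer_M t c\<^sub>2 x) a) = sgn (c\<^sub>2 - c\<^sub>1)"
    using sgn_deriv_quotient[OF has_field_derivative_kummer_M_fst[OF pos(1,2) assms]
        has_field_derivative_kummer_M_fst[OF pos(1,3) assms] kummer_M_pos[OF pos(1,3) assms]]
    by simp
next
  fix a\<^sub>1 a\<^sub>2 c :: real
  assume "c > a\<^sub>1 \<and> c > a\<^sub>2 \<and> a\<^sub>1 > 0 \<and> a\<^sub>2 > 0"
  then have pos: "a\<^sub>1 > 0" "a\<^sub>2 > 0" "c > 0" by auto
  let ?S = "\<lambda>a. \<Sum>j. kummer_term a c x j * shifted_harm c j"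
  \<comment> \<open>The minus signs of the \<open>c\<close>-derivatives reverse the increase of the
    means in the first parameter, giving \<open>a\<^sub>2 - a\<^sub>1\<close>.\<close>
  have "sgn (- ?S a\<^sub>1 * kummer_M a\<^sub>2 c x - kummer_M a\<^sub>1 c x * - ?S a\<^sub>2) = sgn (a\<^sub>2 - a\<^sub>1)"
    using kummer_harm_mean_less_fst[of a\<^sub>1 a\<^sub>2 c x] kummer_harm_mean_less_fst[of a\<^sub>2 a\<^sub>1 c x] pos assms
    by (cases a\<^sub>1 a\<^sub>2 rule: linorder_cases) (auto simp: mult.commute)
  then show "(\<lambda>t. kummer_M a\<^sub>1 t x / kummer_M a\<^sub>2 t x) field_differentiable (at c) \<and>
      sgn (deriv (\<lambda>t. kummer_M a\<^sub>1 t x / kummer_M a\<^sub>2 t x) c) = sgn (a\<^sub>2 - a\<^sub>1)"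
    using sgn_deriv_quotient[OF has_field_derivative_kummer_M_snd[OF pos(1,3) assms]
        has_field_derivative_kummer_M_snd[OF pos(2,3) assms] kummer_M_pos[OF pos(2,3) assms]]
    by simp
qed

end
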